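(* Involutive residuated lattices are term-equivalent to involutive semirings.
   Context: A 0-free semiring is an algebra $(A,+,\cdot,1)$ such that $(A,+)$ is a commutative semigroup, $(A,\cdot,1)$ is a monoid, and $a(b+c)=ab+ac$, $(a+b)c=ac+bc$ for all $a,b,c\in A$. It is idempotent if $a+a=a$ for all $a$; then $+$ is written $\vee$ and $(A,\vee)$ is a join-semilattice with order $x\le y\iff x\vee y=y$. An involutive residuated lattice is an algebra $(A,\vee,\wedge,\cdot,1,\backslash,/,0)$ such that $(A,\vee,\wedge)$ is a lattice (with order $x\le y\iff x\vee y=y$), $(A,\cdot,1)$ is a monoid, the residuation property $xy\le z\iff x\le z/y\iff y\le x\backslash z$ holds for all $x,y,z\in A$, $0$ is a constant (not necessarily the least element), and, writing ${\sim}x=x\backslash 0$ and $-x=0/x$, the identities ${\sim}{-}x=x=-{\sim}x$ hold for all $x\in A$. An involutive semiring is an algebra $(A,\vee,\cdot,1,{\sim},-)$ with ${\sim},-$ unary operations such that $(A,\vee,\cdot,1)$ is a 0-free idempotent semiring and, for all $x,y\in A$, $x\le y\iff x\cdot{\sim}y\le -1\iff -y\cdot x\le -1$. Two classes of algebras $\mathcal K$ and $\mathcal L$ (in possibly different signatures) are term-equivalent if each basic operation of the signature of $\mathcal L$ can be defined by a term in the signature of $\mathcal K$ and vice versa, in such a way that each algebra in $\mathcal K$ becomes, via these terms, an algebra in $\mathcal L$ on the same underlying set, each algebra in $\mathcal L$ becomes an algebra in $\mathcal K$ on the same underlying set, and these two constructions are mutually inverse. *)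

theory Defs
  imports "HOL-Algebra.Group"
begin

text \<open>
  A signature is a type of operation symbols together with an arity function. An algebra interprets
  a symbol of arity n as a function on lists; only its values at lists of length n over the
  carrier are meaningful, so algebras are compared by \<open>same_algebra\<close> and not by equality.
\<close>

record ('a, 'f) algebra = "'a partial_object" +
  ops :: "'f \<Rightarrow> 'a list \<Rightarrow> 'a"

definition same_algebra ::
    "('f \<Rightarrow> nat) \<Rightarrow> ('a, 'f) algebra \<Rightarrow> ('a, 'f) algebra \<Rightarrow> bool" where
  "same_algebra ar A B \<longleftrightarrow>
     carrier A = carrier B \<and>
     (\<forall>f xs. length xs = ar f \<and> set xs \<subseteq> carrier A \<longrightarrow> ops A f xs = ops B f xs)"

datatype 'f trm = Var nat | App 'f "'f trm list"

fun is_term :: "('f \<Rightarrow> nat) \<Rightarrow> nat \<Rightarrow> 'f trm \<Rightarrow> bool" where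
  "is_term ar n (Var i) \<longleftrightarrow> i < n"
| "is_term ar n (App f ts) \<longleftrightarrow> length ts = ar f \<and> (\<forall>t\<in>set ts. is_term ar n t)"

fun eval :: "('a, 'f) algebra \<Rightarrow> 'a list \<Rightarrow> 'f trm \<Rightarrow> 'a" where
  "eval A xs (Var i) = xs ! i"
| "eval A xs (App f ts) = ops A f (map (eval A xs) ts)"

text \<open>
  A translation assigns to every n-ary symbol of the target signature a term of the source
  signature in the variables \<open>Var 0, \<dots>, Var (n - 1)\<close>.
\<close>

definition translation :: "('f \<Rightarrow> nat) \<Rightarrow> ('g \<Rightarrow> nat) \<Rightarrow> ('g \<Rightarrow> 'f trm) \<Rightarrow> bool" where
  "translation arf arg \<tau> \<longleftrightarrow> (\<forall>g. is_term arf (arg g) (\<tau> g))"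

definition derived :: "('g \<Rightarrow> 'f trm) \<Rightarrow> ('a, 'f) algebra \<Rightarrow> ('a, 'g) algebra" where
  "derived \<tau> A = \<lparr>carrier = carrier A, ops = (\<lambda>g xs. eval A xs (\<tau> g))\<rparr>"

text \<open>
  The argument \<open>U\<close> only names the type whose subsets serve as carriers.
\<close>

definition term_equivalence ::
    "'a itself \<Rightarrow> ('f \<Rightarrow> nat) \<Rightarrow> (('a, 'f) algebra \<Rightarrow> bool) \<Rightarrow> ('g \<Rightarrow> nat) \<Rightarrow> (('a, 'g) algebra \<Rightarrow> bool) \<Rightarrow>
     ('g \<Rightarrow> 'f trm) \<Rightarrow> ('f \<Rightarrow> 'g trm) \<Rightarrow> bool" where
  "term_equivalence U arK K arL L \<tau> \<sigma> \<longleftrightarrow>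
     translation arK arL \<tau> \<and> translation arL arK \<sigma> \<and>
     (\<forall>A. K A \<longrightarrow> L (derived \<tau> A)) \<and>
     (\<forall>B. L B \<longrightarrow> K (derived \<sigma> B)) \<and>
     (\<forall>A. K A \<longrightarrow> same_algebra arK (derived \<sigma> (derived \<tau> A)) A) \<and>
     (\<forall>B. L B \<longrightarrow> same_algebra arL (derived \<tau> (derived \<sigma> B)) B)"

definition term_equivalent ::
    "'a itself \<Rightarrow> ('f \<Rightarrow> nat) \<Rightarrow> (('a, 'f) algebra \<Rightarrow> bool) \<Rightarrow> ('g \<Rightarrow> nat) \<Rightarrow> (('a, 'g) algebra \<Rightarrow> bool) \<Rightarrow>
     bool" where
  "term_equivalent U arK K arL L \<longleftrightarrow> (\<exists>\<tau> \<sigma>. term_equivalence U arK K arL L \<tau> \<sigma>)"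

locale involutive_residuated_lattice =
  fixes A :: "'a set"
    and join :: "'a \<Rightarrow> 'a \<Rightarrow> 'a"  (infixl "\<or>\<or>" 65)
    and meet :: "'a \<Rightarrow> 'a \<Rightarrow> 'a"  (infixl "\<and>\<and>" 68)
    and times :: "'a \<Rightarrow> 'a \<Rightarrow> 'a"  (infixl "\<cdot>" 70)
    and unit :: 'a
    and ldiv :: "'a \<Rightarrow> 'a \<Rightarrow> 'a"
    and rdiv :: "'a \<Rightarrow> 'a \<Rightarrow> 'a"
    and zero :: 'a
  fixes le :: "'a \<Rightarrow> 'a \<Rightarrow> bool"  (infix "\<preceq>" 50)
    and tilde :: "'a \<Rightarrow> 'a"
    and minus :: "'a \<Rightarrow> 'a"
  defines "x \<preceq> y \<equiv> x \<or>\<or> y = y"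
    and "tilde x \<equiv> ldiv x zero"
    and "minus x \<equiv> rdiv zero x"
  assumes join_closed: "\<lbrakk>x \<in> A; y \<in> A\<rbrakk> \<Longrightarrow> x \<or>\<or> y \<in> A"
    and meet_closed: "\<lbrakk>x \<in> A; y \<in> A\<rbrakk> \<Longrightarrow> x \<and>\<and> y \<in> A"
    and ldiv_closed: "\<lbrakk>x \<in> A; y \<in> A\<rbrakk> \<Longrightarrow> ldiv x y \<in> A"
    and rdiv_closed: "\<lbrakk>x \<in> A; y \<in> A\<rbrakk> \<Longrightarrow> rdiv x y \<in> A"
    and zero_closed: "zero \<in> A"
    and join_assoc: "\<lbrakk>x \<in> A; y \<in> A; z \<in> A\<rbrakk> \<Longrightarrow> (x \<or>\<or> y) \<or>\<or> z = x \<or>\<or> (y \<or>\<or> z)"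
    and meet_assoc: "\<lbrakk>x \<in> A; y \<in> A; z \<in> A\<rbrakk> \<Longrightarrow> (x \<and>\<and> y) \<and>\<and> z = x \<and>\<and> (y \<and>\<and> z)"
    and join_comm: "\<lbrakk>x \<in> A; y \<in> A\<rbrakk> \<Longrightarrow> x \<or>\<or> y = y \<or>\<or> x"
    and meet_comm: "\<lbrakk>x \<in> A; y \<in> A\<rbrakk> \<Longrightarrow> x \<and>\<and> y = y \<and>\<and> x"
    and join_absorb: "\<lbrakk>x \<in> A; y \<in> A\<rbrakk> \<Longrightarrow> x \<or>\<or> (x \<and>\<and> y) = x"
    and meet_absorb: "\<lbrakk>x \<in> A; y \<in> A\<rbrakk> \<Longrightarrow> x \<and>\<and> (x \<or>\<or> y) = x"
    and times_monoid: "monoid \<lparr>carrier = A, monoid.mult = (\<cdot>), one = unit\<rparr>"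
    and residuation_right: "\<lbrakk>x \<in> A; y \<in> A; z \<in> A\<rbrakk> \<Longrightarrow> x \<cdot> y \<preceq> z \<longleftrightarrow> x \<preceq> rdiv z y"
    and residuation_left: "\<lbrakk>x \<in> A; y \<in> A; z \<in> A\<rbrakk> \<Longrightarrow> x \<cdot> y \<preceq> z \<longleftrightarrow> y \<preceq> ldiv x z"
    and tilde_minus: "x \<in> A \<Longrightarrow> tilde (minus x) = x"
    and minus_tilde: "x \<in> A \<Longrightarrow> minus (tilde x) = x"

datatype irl_op = RJoin | RMeet | RTimes | ROne | RLdiv | RRdiv | RZero

primrec irl_arity :: "irl_op \<Rightarrow> nat" where
  "irl_arity RJoin = 2"
| "irl_arity RMeet = 2"
| "irl_arity RTimes = 2"
| "irl_arity ROne = 0"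
| "irl_arity RLdiv = 2"
| "irl_arity RRdiv = 2"
| "irl_arity RZero = 0"

text \<open>In \<open>RLdiv\<close> the divisor is the first argument, in \<open>RRdiv\<close> the second.\<close>

definition irl :: "('a, irl_op) algebra \<Rightarrow> bool" where
  "irl A \<longleftrightarrow> involutive_residuated_lattice (carrier A)
     (\<lambda>x y. ops A RJoin [x, y]) (\<lambda>x y. ops A RMeet [x, y])
     (\<lambda>x y. ops A RTimes [x, y]) (ops A ROne [])
     (\<lambda>x y. ops A RLdiv [x, y]) (\<lambda>x y. ops A RRdiv [x, y]) (ops A RZero [])"

locale zero_free_semiring =
  fixes A :: "'a set"
    and add :: "'a \<Rightarrow> 'a \<Rightarrow> 'a"  (infixl "\<or>\<or>" 65)
    and times :: "'a \<Rightarrow> 'a \<Rightarrow> 'a"  (infixl "\<cdot>" 70)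
    and unit :: 'a
  assumes add_closed: "\<lbrakk>x \<in> A; y \<in> A\<rbrakk> \<Longrightarrow> x \<or>\<or> y \<in> A"
    and add_assoc: "\<lbrakk>x \<in> A; y \<in> A; z \<in> A\<rbrakk> \<Longrightarrow> (x \<or>\<or> y) \<or>\<or> z = x \<or>\<or> (y \<or>\<or> z)"
    and add_comm: "\<lbrakk>x \<in> A; y \<in> A\<rbrakk> \<Longrightarrow> x \<or>\<or> y = y \<or>\<or> x"
    and times_monoid: "monoid \<lparr>carrier = A, monoid.mult = (\<cdot>), one = unit\<rparr>"
    and distrib_left: "\<lbrakk>x \<in> A; y \<in> A; z \<in> A\<rbrakk> \<Longrightarrow> x \<cdot> (y \<or>\<or> z) = x \<cdot> y \<or>\<or> x \<cdot> z"
    and distrib_right: "\<lbrakk>x \<in> A; y \<in> A; z \<in> A\<rbrakk> \<Longrightarrow> (x \<or>\<or> y) \<cdot> z = x \<cdot> z \<or>\<or> y \<cdot> z"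

locale idempotent_zero_free_semiring = zero_free_semiring +
  assumes add_idem: "x \<in> A \<Longrightarrow> x \<or>\<or> x = x"

locale involutive_semiring = idempotent_zero_free_semiring +
  fixes tilde :: "'a \<Rightarrow> 'a"
    and minus :: "'a \<Rightarrow> 'a"
  fixes le :: "'a \<Rightarrow> 'a \<Rightarrow> bool"  (infix "\<preceq>" 50)
  defines "x \<preceq> y \<equiv> x \<or>\<or> y = y"
  assumes tilde_closed: "x \<in> A \<Longrightarrow> tilde x \<in> A"
    and minus_closed: "x \<in> A \<Longrightarrow> minus x \<in> A"
    and le_iff_tilde: "\<lbrakk>x \<in> A; y \<in> A\<rbrakk> \<Longrightarrow> x \<preceq> y \<longleftrightarrow> x \<cdot> tilde y \<preceq> minus unit"
    and le_iff_minus: "\<lbrakk>x \<in> A; y \<in> A\<rbrakk> \<Longrightarrow> x \<preceq> y \<longleftrightarrow> minus y \<cdot> x \<preceq> minus unit"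

datatype isr_op = SJoin | STimes | SOne | STilde | SMinus

primrec isr_arity :: "isr_op \<Rightarrow> nat" where
  "isr_arity SJoin = 2"
| "isr_arity STimes = 2"
| "isr_arity SOne = 0"
| "isr_arity STilde = 1"
| "isr_arity SMinus = 1"

definition isr :: "('a, isr_op) algebra \<Rightarrow> bool" where
  "isr A \<longleftrightarrow> involutive_semiring (carrier A)
     (\<lambda>x y. ops A SJoin [x, y]) (\<lambda>x y. ops A STimes [x, y]) (ops A SOne [])
     (\<lambda>x. ops A STilde [x]) (\<lambda>x. ops A SMinus [x])"

end

theory Submission
  imports Defs "HOL-Library.Countable_Set"
begin

text \<open>
  The two inequalities defining an involutive semiring say that \<open>\<sim>y \<le> z \<longleftrightarrow> -z \<le> y\<close>, so \<open>\<sim>\<close> and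
  \<open>-\<close> are mutually inverse dual order isomorphisms. The meet is then the De Morgan dual of the
  join, \<open>0 = -1 = \<sim>1\<close>, and since \<open>xy \<le> z\<close> means \<open>(-z)xy \<le> 0\<close> and also \<open>xy(\<sim>z) \<le> 0\<close>, the residuals
  are \<open>x\z = \<sim>((-z)x)\<close> and \<open>z/y = -(y(\<sim>z))\<close>.

  Both classes are axiomatized by universal sentences, and the finitely many elements
  occurring in an instance of an axiom or of a translated operation lie in a countable
  subalgebra. Hence a term equivalence over \<open>nat\<close> is one over every type.
\<close>

section \<open>Residuation from the semiring inequalities\<close>

context involutive_semiring
begin

lemma mult_closed [simp]: "\<lbrakk>x \<in> A; y \<in> A\<rbrakk> \<Longrightarrow> x \<cdot> y \<in> A"
  using monoid.m_closed[OF times_monoid] by simp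

lemma unit_closed [simp]: "unit \<in> A"
  using monoid.one_closed[OF times_monoid] by simp

lemma mult_assoc: "\<lbrakk>x \<in> A; y \<in> A; z \<in> A\<rbrakk> \<Longrightarrow> (x \<cdot> y) \<cdot> z = x \<cdot> (y \<cdot> z)"
  using monoid.m_assoc[OF times_monoid] by simp

lemma mult_unit [simp]: "x \<in> A \<Longrightarrow> unit \<cdot> x = x" "x \<in> A \<Longrightarrow> x \<cdot> unit = x"
  using monoid.l_one[OF times_monoid] monoid.r_one[OF times_monoid] by simp_all

declare add_closed [simp] tilde_closed [simp] minus_closed [simp] add_idem [simp]

lemma le_refl [simp]: "x \<in> A \<Longrightarrow> x \<preceq> x"
  by (simp add: le_def)

lemma le_antisym: "\<lbrakk>x \<preceq> y; y \<preceq> x; x \<in> A; y \<in> A\<rbrakk> \<Longrightarrow> x = y"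
  by (metis le_def add_comm)

lemma le_trans: "\<lbrakk>x \<preceq> y; y \<preceq> z; x \<in> A; y \<in> A; z \<in> A\<rbrakk> \<Longrightarrow> x \<preceq> z"
  by (metis le_def add_assoc)

lemma le_join: "\<lbrakk>x \<in> A; y \<in> A\<rbrakk> \<Longrightarrow> x \<preceq> x \<or>\<or> y"
  by (metis le_def add_assoc add_idem)

text \<open>Both sides say \<open>minus z \<cdot> tilde y \<preceq> minus unit\<close>. This is an
  antitone Galois connection, from which monotonicity reversal and one half of each involution law
  follow.\<close>

lemma tilde_le_iff: "\<lbrakk>y \<in> A; z \<in> A\<rbrakk> \<Longrightarrow> tilde y \<preceq> z \<longleftrightarrow> minus z \<preceq> y"
  using le_iff_minus[of "tilde y" z] le_iff_tilde[of "minus z" y] by simp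

lemma tilde_minus_le: "z \<in> A \<Longrightarrow> tilde (minus z) \<preceq> z"
  by (simp add: tilde_le_iff)

lemma minus_tilde_le: "z \<in> A \<Longrightarrow> minus (tilde z) \<preceq> z"
  using tilde_le_iff[of z "tilde z"] by simp

lemma minus_antimono: "\<lbrakk>x \<preceq> y; x \<in> A; y \<in> A\<rbrakk> \<Longrightarrow> minus y \<preceq> minus x"
  using le_trans[OF tilde_minus_le, of x y] by (simp add: tilde_le_iff)

lemma tilde_antimono: "\<lbrakk>x \<preceq> y; x \<in> A; y \<in> A\<rbrakk> \<Longrightarrow> tilde y \<preceq> tilde x"
  using le_trans[OF minus_tilde_le, of x y] by (simp add: tilde_le_iff)

text \<open>The Galois connection alone gives only \<open>tilde (minus x) \<preceq> x\<close>. For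
  the converse, the triple negation collapses to \<open>minus x\<close>, so the product test for
  \<open>x \<preceq> tilde (minus x)\<close> becomes the one for
  \<open>x \<preceq> x\<close>.\<close>

lemma tilde_minus [simp]:
  assumes "x \<in> A"
  shows "tilde (minus x) = x"
proof (rule le_antisym)
  have "minus (tilde (minus x)) = minus x"
    using assms minus_antimono[OF tilde_minus_le[OF assms]] minus_tilde_le[of "minus x"]
    by (intro le_antisym) auto
  then have "minus (tilde (minus x)) \<cdot> x \<preceq> minus unit"
    using assms le_iff_minus[of x x] by simp
  then show "x \<preceq> tilde (minus x)"
    using assms le_iff_minus[of x "tilde (minus x)"] by simp
qed (use assms tilde_minus_le in auto)

lemma minus_tilde [simp]:
  assumes "x \<in> A"
  shows "minus (tilde x) = x"
proof (rule le_antisym)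
  \<comment> \<open>The triple negation is now an instance of \<open>tilde_minus\<close>, so no
    second antitonicity argument is needed.\<close>
  have "tilde (minus (tilde x)) = tilde x"
    using assms by simp
  then have "x \<cdot> tilde (minus (tilde x)) \<preceq> minus unit"
    using assms le_iff_tilde[of x x] by simp
  then show "x \<preceq> minus (tilde x)"
    using assms le_iff_tilde[of x "minus (tilde x)"] by simp
qed (use assms minus_tilde_le in auto)

text \<open>This makes a single constant 0 possible: the bound \<open>minus unit\<close> in the
  semiring inequalities serves both negations.\<close>

lemma tilde_unit [simp]: "tilde unit = minus unit"
proof (rule le_antisym)
  show "tilde unit \<preceq> minus unit"
    using le_iff_tilde[of unit unit] by simp
  show "minus unit \<preceq> tilde unit"
    using le_iff_minus[of "minus unit" "tilde unit"] by simp
qed auto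

lemma minus_minus_unit [simp]: "minus (minus unit) = unit"
  using minus_tilde[of unit] by simp

text \<open>After cancelling \<open>tilde (minus _)\<close>, both sides read
  \<open>x \<cdot> y \<cdot> tilde z \<preceq> minus unit\<close> up to associativity.\<close>

lemma le_rdiv_iff:
  "\<lbrakk>x \<in> A; y \<in> A; z \<in> A\<rbrakk> \<Longrightarrow> x \<cdot> y \<preceq> z \<longleftrightarrow> x \<preceq> minus (y \<cdot> tilde z)"
  using le_iff_tilde[of "x \<cdot> y" z] le_iff_tilde[of x "minus (y \<cdot> tilde z)"]
  by (simp add: mult_assoc)

text \<open>Mirror image of \<open>le_rdiv_iff\<close>: both sides read
  \<open>minus z \<cdot> x \<cdot> y \<preceq> minus unit\<close>.\<close>

lemma le_ldiv_iff:
  "\<lbrakk>x \<in> A; y \<in> A; z \<in> A\<rbrakk> \<Longrightarrow> x \<cdot> y \<preceq> z \<longleftrightarrow> y \<preceq> tilde (minus z \<cdot> x)"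
  using le_iff_minus[of "x \<cdot> y" z] le_iff_minus[of y "tilde (minus z \<cdot> x)"]
  by (simp add: mult_assoc)

lemma meet_le: "\<lbrakk>x \<in> A; y \<in> A\<rbrakk> \<Longrightarrow> tilde (minus x \<or>\<or> minus y) \<preceq> x"
  using tilde_antimono[OF le_join, of "minus x" "minus y"] by simp

lemma involutive_residuated_lattice:
  "involutive_residuated_lattice A (\<or>\<or>) (\<lambda>x y. tilde (minus x \<or>\<or> minus y)) (\<cdot>) unit
     (\<lambda>x y. tilde (minus y \<cdot> x)) (\<lambda>x y. minus (y \<cdot> tilde x)) (minus unit)"
proof (rule involutive_residuated_lattice.intro, goal_cases)
  case (8 x y)
  then show ?case by (rule add_comm)
next
  case (9 x y)
  then show ?case by (simp add: add_comm[of "minus x"])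
next
  case (10 x y)
  then show ?case
    using meet_le[of x y] by (metis le_def add_comm add_closed minus_closed tilde_closed)
next
  case (11 x y)
  \<comment> \<open>Absorption for the De Morgan meet: \<open>minus (x \<or>\<or> y)\<close> is
    absorbed by \<open>minus x\<close> in the join, and \<open>tilde\<close> of what remains is
    \<open>x\<close>.\<close>
  then have "minus (x \<or>\<or> y) \<preceq> minus x"
    using minus_antimono[OF le_join] by simp
  then show ?case
    using 11 by (simp add: le_def add_comm)
next
  case (13 x y z)
  then show ?case
    using le_rdiv_iff by (simp add: le_def)
next
  case (14 x y z)
  then show ?case
    using le_ldiv_iff by (simp add: le_def)
qed (auto simp: add_assoc times_monoid)

text \<open>Round trip for the negations: with 0 taken as \<open>minus unit\<close>, the left sides
  here and in \<open>minus_eq\<close> are the constructed residuals x under 0 and 0 over x.\<close>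

lemma tilde_eq: "x \<in> A \<Longrightarrow> tilde (minus (minus unit) \<cdot> x) = tilde x"
  by simp

lemma minus_eq: "x \<in> A \<Longrightarrow> minus (x \<cdot> tilde (minus unit)) = minus x"
  by simp

end

section \<open>The semiring inequalities from residuation\<close>

context involutive_residuated_lattice
begin

lemma mult_closed [simp]: "\<lbrakk>x \<in> A; y \<in> A\<rbrakk> \<Longrightarrow> x \<cdot> y \<in> A"
  using monoid.m_closed[OF times_monoid] by simp

lemma unit_closed [simp]: "unit \<in> A"
  using monoid.one_closed[OF times_monoid] by simp

lemma mult_assoc: "\<lbrakk>x \<in> A; y \<in> A; z \<in> A\<rbrakk> \<Longrightarrow> (x \<cdot> y) \<cdot> z = x \<cdot> (y \<cdot> z)"
  using monoid.m_assoc[OF times_monoid] by simp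

lemma mult_unit [simp]: "x \<in> A \<Longrightarrow> unit \<cdot> x = x" "x \<in> A \<Longrightarrow> x \<cdot> unit = x"
  using monoid.l_one[OF times_monoid] monoid.r_one[OF times_monoid] by simp_all

declare join_closed [simp] meet_closed [simp] ldiv_closed [simp] rdiv_closed [simp]
  zero_closed [simp] tilde_minus [simp] minus_tilde [simp]

lemma tilde_closed [simp]: "x \<in> A \<Longrightarrow> tilde x \<in> A"
  and minus_closed [simp]: "x \<in> A \<Longrightarrow> minus x \<in> A"
  by (simp_all add: tilde_def minus_def)

lemma join_idem [simp]: "x \<in> A \<Longrightarrow> x \<or>\<or> x = x"
  by (metis join_absorb meet_absorb join_closed)

lemma le_refl [simp]: "x \<in> A \<Longrightarrow> x \<preceq> x"
  by (simp add: le_def)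

lemma le_antisym: "\<lbrakk>x \<preceq> y; y \<preceq> x; x \<in> A; y \<in> A\<rbrakk> \<Longrightarrow> x = y"
  by (metis le_def join_comm)

lemma join_le_iff: "\<lbrakk>x \<in> A; y \<in> A; z \<in> A\<rbrakk> \<Longrightarrow> x \<or>\<or> y \<preceq> z \<longleftrightarrow> x \<preceq> z \<and> y \<preceq> z"
  by (smt (verit) le_def join_assoc join_comm join_idem join_closed)

lemma le_iff_meet: "\<lbrakk>x \<in> A; y \<in> A\<rbrakk> \<Longrightarrow> x \<preceq> y \<longleftrightarrow> x \<and>\<and> y = x"
  by (metis le_def join_comm meet_comm join_absorb meet_absorb)

lemma le_meet_iff: "\<lbrakk>x \<in> A; y \<in> A; z \<in> A\<rbrakk> \<Longrightarrow> z \<preceq> x \<and>\<and> y \<longleftrightarrow> z \<preceq> x \<and> z \<preceq> y"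
  by (smt (verit) le_iff_meet meet_assoc meet_comm meet_closed join_absorb le_def join_comm)

text \<open>Equality in a poset can be tested on upper bounds, and dually on lower bounds. In this
  form an identity reduces to a chain of residuation equivalences.\<close>

lemma eq_if_same_upper:
  "\<lbrakk>\<And>u. u \<in> A \<Longrightarrow> x \<preceq> u \<longleftrightarrow> y \<preceq> u; x \<in> A; y \<in> A\<rbrakk> \<Longrightarrow> x = y"
  by (meson le_antisym le_refl)

lemma eq_if_same_lower:
  "\<lbrakk>\<And>u. u \<in> A \<Longrightarrow> u \<preceq> x \<longleftrightarrow> u \<preceq> y; x \<in> A; y \<in> A\<rbrakk> \<Longrightarrow> x = y"
  by (meson le_antisym le_refl)

lemma le_tilde_iff: "\<lbrakk>x \<in> A; y \<in> A\<rbrakk> \<Longrightarrow> y \<preceq> tilde x \<longleftrightarrow> x \<cdot> y \<preceq> zero"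
  by (simp add: tilde_def residuation_left)

lemma le_minus_iff: "\<lbrakk>x \<in> A; y \<in> A\<rbrakk> \<Longrightarrow> y \<preceq> minus x \<longleftrightarrow> y \<cdot> x \<preceq> zero"
  by (simp add: minus_def residuation_right)

lemma minus_unit [simp]: "minus unit = zero"
  by (rule eq_if_same_lower) (simp_all add: le_minus_iff)

text \<open>Write \<open>y\<close> as \<open>minus (tilde y)\<close> and apply residuation with
  target \<open>zero\<close>; \<open>le_iff_minus\<close> is dual.\<close>

lemma le_iff_tilde: "\<lbrakk>x \<in> A; y \<in> A\<rbrakk> \<Longrightarrow> x \<preceq> y \<longleftrightarrow> x \<cdot> tilde y \<preceq> zero"
  using le_minus_iff[of "tilde y" x] by simp

lemma le_iff_minus: "\<lbrakk>x \<in> A; y \<in> A\<rbrakk> \<Longrightarrow> x \<preceq> y \<longleftrightarrow> minus y \<cdot> x \<preceq> zero"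
  using le_tilde_iff[of "minus y" x] by simp

text \<open>Multiplication by \<open>x\<close> is a left adjoint, hence preserves joins: both sides
  lie below \<open>u\<close> iff \<open>y\<close> and \<open>z\<close> lie below
  \<open>ldiv x u\<close>.\<close>

lemma distrib_left:
  assumes "x \<in> A" "y \<in> A" "z \<in> A"
  shows "x \<cdot> (y \<or>\<or> z) = x \<cdot> y \<or>\<or> x \<cdot> z"
  by (rule eq_if_same_upper) (use assms in \<open>simp_all add: join_le_iff residuation_left\<close>)

lemma distrib_right:
  assumes "x \<in> A" "y \<in> A" "z \<in> A"
  shows "(x \<or>\<or> y) \<cdot> z = x \<cdot> z \<or>\<or> y \<cdot> z"
  by (rule eq_if_same_upper) (use assms in \<open>simp_all add: join_le_iff residuation_right\<close>)

lemma involutive_semiring: "involutive_semiring A (\<or>\<or>) (\<cdot>) unit tilde minus"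
proof (unfold_locales, goal_cases)
  case (3 x y)
  then show ?case by (rule join_comm)
next
  case 14
  then show ?case using le_iff_tilde by (simp add: le_def)
next
  case 15
  then show ?case using le_iff_minus by (simp add: le_def)
qed (auto simp: join_assoc mult_assoc distrib_left distrib_right)

text \<open>For every \<open>u\<close>, membership below either side means
  \<open>minus y \<cdot> x \<cdot> u \<preceq> zero\<close>, that is,
  \<open>x \<cdot> u \<preceq> y\<close>. Thus the residual is recovered from the negations;
  \<open>rdiv_eq\<close> is the mirror image.\<close>

lemma ldiv_eq:
  assumes "x \<in> A" "y \<in> A"
  shows "tilde (minus y \<cdot> x) = ldiv x y"
proof (rule eq_if_same_lower)
  fix u assume "u \<in> A"
  then show "u \<preceq> tilde (minus y \<cdot> x) \<longleftrightarrow> u \<preceq> ldiv x y"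
    using assms le_iff_minus[of "x \<cdot> u" y]
    by (simp add: le_tilde_iff mult_assoc flip: residuation_left)
qed (use assms in auto)

lemma rdiv_eq:
  assumes "x \<in> A" "y \<in> A"
  shows "minus (y \<cdot> tilde x) = rdiv x y"
proof (rule eq_if_same_lower)
  fix u assume "u \<in> A"
  then show "u \<preceq> minus (y \<cdot> tilde x) \<longleftrightarrow> u \<preceq> rdiv x y"
    using assms le_iff_tilde[of "u \<cdot> y" x]
    by (simp add: le_minus_iff mult_assoc flip: residuation_right)
qed (use assms in auto)

text \<open>By distributivity, \<open>u\<close> is below the left side iff
  \<open>minus x \<cdot> u\<close> and \<open>minus y \<cdot> u\<close> are both below
  \<open>zero\<close>, which says that \<open>u\<close> is a common lower bound of \<open>x\<close>
  and \<open>y\<close>.\<close>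

lemma meet_eq:
  assumes "x \<in> A" "y \<in> A"
  shows "tilde (minus x \<or>\<or> minus y) = x \<and>\<and> y"
proof (rule eq_if_same_lower)
  fix u assume "u \<in> A"
  then show "u \<preceq> tilde (minus x \<or>\<or> minus y) \<longleftrightarrow> u \<preceq> x \<and>\<and> y"
    using assms le_iff_minus[of u x] le_iff_minus[of u y]
    by (simp add: le_tilde_iff distrib_right join_le_iff le_meet_iff)
qed (use assms in auto)

end

section \<open>Algebras and embeddings\<close>

definition closed_algebra :: "('f \<Rightarrow> nat) \<Rightarrow> ('a, 'f) algebra \<Rightarrow> bool" where
  "closed_algebra ar A \<longleftrightarrow>
     (\<forall>f xs. length xs = ar f \<and> set xs \<subseteq> carrier A \<longrightarrow> ops A f xs \<in> carrier A)"

text \<open>Closure of \<open>N\<close> is included because the homomorphism equation covers only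
  arguments in its carrier, and nested terms feed values of subterms back into operations.\<close>

definition embedding ::
    "('f \<Rightarrow> nat) \<Rightarrow> ('b \<Rightarrow> 'a) \<Rightarrow> ('b, 'f) algebra \<Rightarrow> ('a, 'f) algebra \<Rightarrow> bool" where
  "embedding ar h N A \<longleftrightarrow>
     closed_algebra ar N \<and> inj_on h (carrier N) \<and> h ` carrier N \<subseteq> carrier A \<and>
     (\<forall>f xs. length xs = ar f \<and> set xs \<subseteq> carrier N \<longrightarrow> h (ops N f xs) = ops A f (map h xs))"

lemma closed_algebraD:
  "\<lbrakk>closed_algebra ar A; length xs = ar f; set xs \<subseteq> carrier A\<rbrakk> \<Longrightarrow> ops A f xs \<in> carrier A"
  by (simp add: closed_algebra_def)

lemma eval_closed:
  assumes "closed_algebra ar A" "is_term ar (length xs) t" "set xs \<subseteq> carrier A"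
  shows "eval A xs t \<in> carrier A"
  using assms(2)
proof (induction t)
  case (Var i)
  then show ?case using assms(3) by auto
next
  case (App f ts)
  then show ?case
    using closed_algebraD[OF assms(1), of "map (eval A xs) ts" f] by auto
qed

lemma eval_embedding:
  assumes "embedding ar h N A" "is_term ar (length xs) t" "set xs \<subseteq> carrier N"
  shows "eval A (map h xs) t = h (eval N xs t)"
  using assms(2)
proof (induction t)
  case (App f ts)
  have "set (map (eval N xs) ts) \<subseteq> carrier N"
    using App.prems assms eval_closed[of ar N xs] by (auto simp: embedding_def)
  then have "h (ops N f (map (eval N xs) ts)) = ops A f (map h (map (eval N xs) ts))"
    using App.prems assms(1) unfolding embedding_def by simp
  moreover have "map (eval A (map h xs)) ts = map h (map (eval N xs) ts)"
    using App by auto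
  ultimately show ?case by (simp only: eval.simps)
qed (use assms in auto)

lemma closed_derived:
  "\<lbrakk>translation arf arg \<tau>; closed_algebra arf A\<rbrakk> \<Longrightarrow> closed_algebra arg (derived \<tau> A)"
  unfolding closed_algebra_def[of arg] translation_def derived_def
  using eval_closed[of arf A] by fastforce

text \<open>Derived operations are terms, and \<open>h\<close> commutes with terms; so the same map
  embeds the derived algebras.\<close>

lemma embedding_derived:
  assumes "translation arf arg \<tau>" "embedding arf h N A"
  shows "embedding arg h (derived \<tau> N) (derived \<tau> A)"
  using assms closed_derived[of arf arg \<tau> N] eval_embedding[OF assms(2)]
  by (simp add: embedding_def translation_def derived_def)

instance trm :: (countable) countable
  by countable_datatype

text \<open>The subalgebra generated by \<open>xs\<close> consists of the values of countably many terms, so it can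
  be copied to a set of natural numbers.\<close>

lemma ex_nat_embedding:
  fixes A :: "('a, 'f::countable) algebra"
  assumes A: "closed_algebra ar A" and xs: "set xs \<subseteq> carrier A"
  shows "\<exists>(N :: (nat, 'f) algebra) h ys.
           embedding ar h N A \<and> set ys \<subseteq> carrier N \<and> map h ys = xs"
proof -
  define T :: "'f trm set" where "T = {t. is_term ar (length xs) t}"
  define S where "S = eval A xs ` T"
  \<comment> \<open>\<open>S\<close> is the generated subalgebra; \<open>e\<close> numbers its
    elements injectively, \<open>h\<close> decodes, and the operations of \<open>N\<close> are
    transported along this bijection.\<close>
  define e where "e = to_nat_on S"
  define h where "h = inv_into S e"
  define N :: "(nat, 'f) algebra" where
    "N = \<lparr>carrier = e ` S, ops = (\<lambda>f ys. e (ops A f (map h ys)))\<rparr>"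
  have e: "inj_on e S"
    unfolding e_def S_def by (rule inj_on_to_nat_on) (rule countable_image, simp)
  have h: "h (e x) = x" if "x \<in> S" for x
    using that e by (simp add: h_def)
  have S_carrier: "S \<subseteq> carrier A"
    using eval_closed[OF A] xs by (auto simp: S_def T_def)
  have S_closed: "ops A f zs \<in> S" if zs: "length zs = ar f" "set zs \<subseteq> S" for f zs
  proof -
    \<comment> \<open>Choosing a term for each argument at once exhibits the result of the operation
      as the value of a compound term.\<close>
    have "zs \<in> map (eval A xs) ` lists T"
      using zs(2) by (auto simp: S_def simp flip: lists_image)
    then obtain ts where ts: "zs = map (eval A xs) ts" "set ts \<subseteq> T"
      by auto
    then have "App f ts \<in> T"
      using zs(1) by (auto simp: T_def)
    then show ?thesis
      unfolding S_def using ts(1) by (intro image_eqI[of _ _ "App f ts"]) simp_all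
  qed
  have hS: "set (map h ys) \<subseteq> S" if "set ys \<subseteq> e ` S" for ys
    using that h by auto
  have "embedding ar h N A"
    unfolding embedding_def closed_algebra_def
  proof (intro conjI allI impI)
    show "inj_on h (carrier N)"
      using h by (auto simp: N_def inj_on_def)
    show "h ` carrier N \<subseteq> carrier A"
      using h S_carrier by (auto simp: N_def)
  next
    fix f ys assume ys: "length ys = ar f \<and> set ys \<subseteq> carrier N"
    then have "ops A f (map h ys) \<in> S"
      using hS by (intro S_closed) (auto simp: N_def)
    then show "ops N f ys \<in> carrier N" "h (ops N f ys) = ops A f (map h ys)"
      using h by (auto simp: N_def)
  qed
  \<comment> \<open>The generators are the values of the variables.\<close>
  moreover have xsS: "set xs \<subseteq> S"
  proof
    fix x assume "x \<in> set xs"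
    then obtain i where "i < length xs" "x = xs ! i"
      by (auto simp: in_set_conv_nth)
    then show "x \<in> S"
      unfolding S_def T_def by (intro image_eqI[of _ _ "Var i"]) auto
  qed
  then have "set (map e xs) \<subseteq> carrier N" "map h (map e xs) = xs"
    using h by (auto simp: N_def intro!: map_idI)
  ultimately show ?thesis by blast
qed

section \<open>Universal classes\<close>

text \<open>Equations alone would not express residuation or the semiring inequalities; equivalences
  between equations do.\<close>

datatype 'f qf = Eq "'f trm" "'f trm" | Iff "'f qf" "'f qf"

primrec is_qf :: "('f \<Rightarrow> nat) \<Rightarrow> nat \<Rightarrow> 'f qf \<Rightarrow> bool" where
  "is_qf ar n (Eq s t) \<longleftrightarrow> is_term ar n s \<and> is_term ar n t"
| "is_qf ar n (Iff p q) \<longleftrightarrow> is_qf ar n p \<and> is_qf ar n q"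

primrec holds :: "('a, 'f) algebra \<Rightarrow> 'a list \<Rightarrow> 'f qf \<Rightarrow> bool" where
  "holds A xs (Eq s t) \<longleftrightarrow> eval A xs s = eval A xs t"
| "holds A xs (Iff p q) \<longleftrightarrow> (holds A xs p \<longleftrightarrow> holds A xs q)"

definition models :: "('f \<Rightarrow> nat) \<Rightarrow> nat \<Rightarrow> 'f qf set \<Rightarrow> ('a, 'f) algebra \<Rightarrow> bool" where
  "models ar n E A \<longleftrightarrow> closed_algebra ar A \<and>
     (\<forall>xs. length xs = n \<and> set xs \<subseteq> carrier A \<longrightarrow> (\<forall>p\<in>E. holds A xs p))"

text \<open>Injectivity makes \<open>h\<close> reflect equations as well as preserve them, so the
  truth value survives on both sides of an \<open>Iff\<close>.\<close>

lemma holds_embedding: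
  assumes "embedding ar h N A" "is_qf ar (length xs) p" "set xs \<subseteq> carrier N"
  shows "holds A (map h xs) p \<longleftrightarrow> holds N xs p"
  using assms(2)
proof (induction p)
  case (Eq s t)
  moreover have "closed_algebra ar N" "inj_on h (carrier N)"
    using assms(1) by (auto simp: embedding_def)
  ultimately show ?case
    using assms eval_closed[of ar N xs] by (simp add: eval_embedding inj_on_eq_iff)
qed simp

lemma models_embedding:
  assumes "embedding ar h N A" "models ar n E A" "\<forall>p\<in>E. is_qf ar n p"
  shows "models ar n E N"
  unfolding models_def
proof (intro conjI allI impI ballI)
  show "closed_algebra ar N"
    using assms(1) by (simp add: embedding_def)
  fix xs p assume xs: "length xs = n \<and> set xs \<subseteq> carrier N" and p: "p \<in> E"
  have "set (map h xs) \<subseteq> carrier A"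
    using assms(1) xs by (auto simp: embedding_def)
  then have "holds A (map h xs) p"
    using assms(2) xs p by (simp add: models_def)
  then show "holds N xs p"
    using holds_embedding[OF assms(1)] assms(3) xs p by auto
qed

text \<open>Converse direction to \<open>models_embedding\<close>: an instance of an axiom involves
  only \<open>n\<close> elements, so it can be checked in a copy on \<open>nat\<close> that contains
  them.\<close>

lemma models_if_locally:
  fixes A :: "('a, 'f) algebra"
  assumes "closed_algebra ar A" "\<forall>p\<in>E. is_qf ar n p"
    and loc: "\<And>xs. set xs \<subseteq> carrier A \<Longrightarrow>
           \<exists>(N :: (nat, 'f) algebra) h ys.
             embedding ar h N A \<and> set ys \<subseteq> carrier N \<and> map h ys = xs \<and> models ar n E N"
  shows "models ar n E A"
  unfolding models_def
proof (intro conjI allI impI ballI)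
  fix xs p assume xs: "length xs = n \<and> set xs \<subseteq> carrier A" and p: "p \<in> E"
  then obtain N :: "(nat, 'f) algebra" and h ys where N: "embedding ar h N A" "set ys \<subseteq> carrier N" "map h ys = xs"
    "models ar n E N"
    using loc by blast
  then have "length ys = n" using xs by auto
  then have "holds N ys p"
    using N p by (simp add: models_def)
  then show "holds A xs p"
    using holds_embedding[OF N(1)] assms(2) p N \<open>length ys = n\<close> by blast
qed (fact assms(1))

text \<open>Pass down to a subalgebra on \<open>nat\<close>, where \<open>E\<close> persists; use
  the hypothesis there; carry \<open>F\<close> back up along the embedding of the derived
  algebras.\<close>

lemma models_derived_transfer:
  fixes A :: "('a, 'f::countable) algebra" and arg :: "'g \<Rightarrow> nat"
  assumes \<tau>: "translation arf arg \<tau>"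
    and E: "\<forall>p\<in>E. is_qf arf n p" and F: "\<forall>p\<in>F. is_qf arg m p"
    and nat: "\<And>N :: (nat, 'f) algebra. models arf n E N \<Longrightarrow> models arg m F (derived \<tau> N)"
    and A: "models arf n E A"
  shows "models arg m F (derived \<tau> A)"
proof (rule models_if_locally[OF _ F])
  have closed: "closed_algebra arf A"
    using A by (simp add: models_def)
  then show "closed_algebra arg (derived \<tau> A)"
    by (rule closed_derived[OF \<tau>])
  fix xs assume "set xs \<subseteq> carrier (derived \<tau> A)"
  then have "set xs \<subseteq> carrier A"
    by (simp add: derived_def)
  from ex_nat_embedding[OF closed this] obtain N :: "(nat, 'f) algebra" and h ys
    where N: "embedding arf h N A" "set ys \<subseteq> carrier N" "map h ys = xs"
    by blast
  then have "models arg m F (derived \<tau> N)"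
    using models_embedding[OF _ A E] nat by blast
  moreover have "set ys \<subseteq> carrier (derived \<tau> N)"
    using N(2) by (simp add: derived_def)
  ultimately show "\<exists>(N :: (nat, 'g) algebra) h ys. embedding arg h N (derived \<tau> A) \<and> set ys \<subseteq> carrier N \<and>
      map h ys = xs \<and> models arg m F N"
    using embedding_derived[OF \<tau> N(1)] N(3) by blast
qed

lemma same_algebra_derived_transfer:
  fixes A :: "('a, 'f::countable) algebra"
  assumes \<tau>: "translation arf arg \<tau>" and \<sigma>: "translation arg arf \<sigma>"
    and E: "\<forall>p\<in>E. is_qf arf n p"
    and nat: "\<And>N :: (nat, 'f) algebra.
           models arf n E N \<Longrightarrow> same_algebra arf (derived \<sigma> (derived \<tau> N)) N"
    and A: "models arf n E A"
  shows "same_algebra arf (derived \<sigma> (derived \<tau> A)) A"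
  unfolding same_algebra_def
proof (intro conjI allI impI)
  show "carrier (derived \<sigma> (derived \<tau> A)) = carrier A"
    by (simp add: derived_def)
  fix f xs assume "length xs = arf f \<and> set xs \<subseteq> carrier (derived \<sigma> (derived \<tau> A))"
  then have xs: "length xs = arf f" "set xs \<subseteq> carrier A"
    by (auto simp: derived_def)
  have "closed_algebra arf A"
    using A by (simp add: models_def)
  from ex_nat_embedding[OF this xs(2)] obtain N :: "(nat, 'f) algebra" and h ys
    where N: "embedding arf h N A" "set ys \<subseteq> carrier N" "map h ys = xs"
    by blast
  let ?D = "\<lambda>A. derived \<sigma> (derived \<tau> A)"
  have len: "length ys = arf f"
    using N(3) xs(1) by auto
  have ys: "set ys \<subseteq> carrier (?D N)"
    using N(2) by (simp add: derived_def)
  have "same_algebra arf (?D N) N"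
    using models_embedding[OF N(1) A E] nat by blast
  then have "ops (?D N) f ys = ops N f ys"
    using len ys by (simp add: same_algebra_def)
  \<comment> \<open>The same \<open>h\<close> embeds \<open>N\<close> into \<open>A\<close> and the
    round trip of \<open>N\<close> into that of \<open>A\<close>, so the equation in
    \<open>N\<close> is pushed forward to \<open>A\<close>.\<close>
  moreover have "h (ops (?D N) f ys) = ops (?D A) f xs"
    using embedding_derived[OF \<sigma> embedding_derived[OF \<tau> N(1)]] len ys N(3)
    by (simp add: embedding_def)
  moreover have "h (ops N f ys) = ops A f xs"
    using N len by (simp add: embedding_def)
  ultimately show "ops (?D A) f xs = ops A f xs"
    by simp
qed

text \<open>The translation conditions mention no carrier type; each of the other four is an
  instance of one of the two preceding lemmas, with the signatures exchanged for the reverse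
  direction.\<close>

lemma term_equivalence_transfer:
  fixes arf :: "'f::countable \<Rightarrow> nat" and arg :: "'g::countable \<Rightarrow> nat"
  assumes "\<forall>p\<in>E. is_qf arf n p" "\<forall>p\<in>F. is_qf arg m p"
    and "term_equivalence TYPE(nat) arf (models arf n E) arg (models arg m F) \<tau> \<sigma>"
  shows "term_equivalence TYPE('a) arf (models arf n E) arg (models arg m F) \<tau> \<sigma>"
  using assms unfolding term_equivalence_def
  by (auto intro: models_derived_transfer same_algebra_derived_transfer)

section \<open>Both classes are universal\<close>

instance irl_op :: countable
  by countable_datatype

instance isr_op :: countable
  by countable_datatype

abbreviation (input) "X \<equiv> Var 0"
abbreviation (input) "Y \<equiv> Var 1"
abbreviation (input) "Z \<equiv> Var 2"

abbreviation (input) "rjoin s t \<equiv> App RJoin [s, t]"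
abbreviation (input) "rmeet s t \<equiv> App RMeet [s, t]"
abbreviation (input) "rtimes s t \<equiv> App RTimes [s, t]"
abbreviation (input) "rone \<equiv> App ROne []"
abbreviation (input) "rldiv s t \<equiv> App RLdiv [s, t]"
abbreviation (input) "rrdiv s t \<equiv> App RRdiv [s, t]"
abbreviation (input) "rzero \<equiv> App RZero []"

abbreviation (input) "sjoin s t \<equiv> App SJoin [s, t]"
abbreviation (input) "stimes s t \<equiv> App STimes [s, t]"
abbreviation (input) "sone \<equiv> App SOne []"
abbreviation (input) "stilde t \<equiv> App STilde [t]"
abbreviation (input) "sminus t \<equiv> App SMinus [t]"

definition irl_axioms :: "irl_op qf set" where
  "irl_axioms =
    {Eq (rjoin (rjoin X Y) Z) (rjoin X (rjoin Y Z)),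
     Eq (rmeet (rmeet X Y) Z) (rmeet X (rmeet Y Z)),
     Eq (rjoin X Y) (rjoin Y X),
     Eq (rmeet X Y) (rmeet Y X),
     Eq (rjoin X (rmeet X Y)) X,
     Eq (rmeet X (rjoin X Y)) X,
     Eq (rtimes (rtimes X Y) Z) (rtimes X (rtimes Y Z)),
     Eq (rtimes rone X) X,
     Eq (rtimes X rone) X,
     Iff (Eq (rjoin (rtimes X Y) Z) Z) (Eq (rjoin X (rrdiv Z Y)) (rrdiv Z Y)),
     Iff (Eq (rjoin (rtimes X Y) Z) Z) (Eq (rjoin Y (rldiv X Z)) (rldiv X Z)),
     Eq (rldiv (rrdiv rzero X) rzero) X,
     Eq (rrdiv rzero (rldiv X rzero)) X}"

definition isr_axioms :: "isr_op qf set" where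
  "isr_axioms =
    {Eq (sjoin (sjoin X Y) Z) (sjoin X (sjoin Y Z)),
     Eq (sjoin X Y) (sjoin Y X),
     Eq (sjoin X X) X,
     Eq (stimes (stimes X Y) Z) (stimes X (stimes Y Z)),
     Eq (stimes sone X) X,
     Eq (stimes X sone) X,
     Eq (stimes X (sjoin Y Z)) (sjoin (stimes X Y) (stimes X Z)),
     Eq (stimes (sjoin X Y) Z) (sjoin (stimes X Z) (stimes Y Z)),
     Iff (Eq (sjoin X Y) Y) (Eq (sjoin (stimes X (stilde Y)) (sminus sone)) (sminus sone)),
     Iff (Eq (sjoin X Y) Y) (Eq (sjoin (stimes (sminus Y) X) (sminus sone)) (sminus sone))}"

lemma is_qf_irl_axioms: "\<forall>p\<in>irl_axioms. is_qf irl_arity 3 p"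
  by (simp add: irl_axioms_def)

lemma is_qf_isr_axioms: "\<forall>p\<in>isr_axioms. is_qf isr_arity 3 p"
  by (simp add: isr_axioms_def)

lemma all_irl_op:
  "(\<forall>f. P f) \<longleftrightarrow> P RJoin \<and> P RMeet \<and> P RTimes \<and> P ROne \<and> P RLdiv \<and> P RRdiv \<and> P RZero"
  by (metis irl_op.exhaust)

lemma all_isr_op:
  "(\<forall>f. P f) \<longleftrightarrow> P SJoin \<and> P STimes \<and> P SOne \<and> P STilde \<and> P SMinus"
  by (metis isr_op.exhaust)

lemma all_list_0: "(\<forall>xs. length xs = 0 \<and> set xs \<subseteq> S \<longrightarrow> P xs) \<longleftrightarrow> P []"
  by simp

text \<open>Together with \<open>all_list_0\<close> this turns quantification over argument lists of
  fixed length into the elementwise quantifiers of the locales.\<close>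

lemma all_list_Suc:
  "(\<forall>xs. length xs = Suc n \<and> set xs \<subseteq> S \<longrightarrow> P xs) \<longleftrightarrow>
   (\<forall>x\<in>S. \<forall>xs. length xs = n \<and> set xs \<subseteq> S \<longrightarrow> P (x # xs))"
  by (auto simp: length_Suc_conv)

text \<open>\<open>models\<close> quantifies three variables in every axiom, while the locale
  quantifies only those that occur. The constants keep the carrier nonempty, so the two readings
  agree.\<close>

lemma irl_iff_models: "irl A \<longleftrightarrow> models irl_arity 3 irl_axioms A"
  unfolding irl_def involutive_residuated_lattice_def monoid_def models_def closed_algebra_def
    all_irl_op irl_arity.simps numeral_2_eq_2 numeral_3_eq_3 all_list_Suc all_list_0 irl_axioms_def
  by simp (rule iffI; elim conjE; intro conjI ballI allI impI; metis)

lemma isr_iff_models: "isr A \<longleftrightarrow> models isr_arity 3 isr_axioms A"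
  unfolding isr_def involutive_semiring_def idempotent_zero_free_semiring_def
    zero_free_semiring_def involutive_semiring_axioms_def idempotent_zero_free_semiring_axioms_def
    monoid_def models_def closed_algebra_def
    all_isr_op isr_arity.simps numeral_2_eq_2 numeral_3_eq_3 One_nat_def all_list_Suc all_list_0
    isr_axioms_def
  by simp (rule iffI; elim conjE; intro conjI ballI allI impI; metis)

section \<open>The translations\<close>

primrec isr_terms :: "isr_op \<Rightarrow> irl_op trm" where
  "isr_terms SJoin = rjoin X Y"
| "isr_terms STimes = rtimes X Y"
| "isr_terms SOne = rone"
| "isr_terms STilde = rldiv X rzero"
| "isr_terms SMinus = rrdiv rzero X"

text \<open>The divisor is \<open>X\<close> in \<open>RLdiv\<close> and \<open>Y\<close> in
  \<open>RRdiv\<close>; hence the negated argument is \<open>Y\<close> in the former term and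
  \<open>X\<close> in the latter.\<close>

primrec irl_terms :: "irl_op \<Rightarrow> isr_op trm" where
  "irl_terms RJoin = sjoin X Y"
| "irl_terms RMeet = stilde (sjoin (sminus X) (sminus Y))"
| "irl_terms RTimes = stimes X Y"
| "irl_terms ROne = sone"
| "irl_terms RLdiv = stilde (stimes (sminus Y) X)"
| "irl_terms RRdiv = sminus (stimes Y (stilde X))"
| "irl_terms RZero = sminus sone"

lemma term_equivalence_irl_isr:
  "term_equivalence TYPE('a) irl_arity irl isr_arity isr isr_terms irl_terms"
  unfolding term_equivalence_def
proof (intro conjI allI impI)
  show "translation irl_arity isr_arity isr_terms"
    by (simp add: translation_def all_isr_op)
  show "translation isr_arity irl_arity irl_terms"
    by (simp add: translation_def all_irl_op)
next
  fix A :: "('a, irl_op) algebra"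
  assume A: "irl A"
  show "isr (derived isr_terms A)"
    using involutive_residuated_lattice.involutive_semiring[OF A[unfolded irl_def]]
    by (simp add: isr_def derived_def)
  show "same_algebra irl_arity (derived irl_terms (derived isr_terms A)) A"
    \<comment> \<open>Join, product and unit return literally; only the residuals, the meet and the
      constant 0 need an identity.\<close>
    using involutive_residuated_lattice.ldiv_eq[OF A[unfolded irl_def]]
      involutive_residuated_lattice.rdiv_eq[OF A[unfolded irl_def]]
      involutive_residuated_lattice.meet_eq[OF A[unfolded irl_def]]
      involutive_residuated_lattice.minus_unit[OF A[unfolded irl_def]]
    unfolding same_algebra_def all_irl_op irl_arity.simps numeral_2_eq_2 all_list_Suc all_list_0
    by (simp add: derived_def)
next
  fix B :: "('a, isr_op) algebra"
  assume B: "isr B"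
  show "irl (derived irl_terms B)"
    using involutive_semiring.involutive_residuated_lattice[OF B[unfolded isr_def]]
    by (simp add: irl_def derived_def)
  show "same_algebra isr_arity (derived isr_terms (derived irl_terms B)) B"
    using involutive_semiring.tilde_eq[OF B[unfolded isr_def]]
      involutive_semiring.minus_eq[OF B[unfolded isr_def]]
    unfolding same_algebra_def all_isr_op isr_arity.simps numeral_2_eq_2 One_nat_def all_list_Suc all_list_0
    by (simp add: derived_def)
qed

(* The second conjunct makes the terms independent of the type 'a that the carriers are
   taken from: terms found for carriers in nat work for carriers in every type. *)
theorem theorem1:
  "term_equivalent TYPE('a) irl_arity irl isr_arity isr \<and>
   (\<forall>\<tau> \<sigma>. term_equivalence TYPE(nat) irl_arity irl isr_arity isr \<tau> \<sigma> \<longrightarrow>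
          term_equivalence TYPE('a) irl_arity irl isr_arity isr \<tau> \<sigma>)"
proof (intro conjI allI impI)
  show "term_equivalent TYPE('a) irl_arity irl isr_arity isr"
    unfolding term_equivalent_def using term_equivalence_irl_isr by blast
next
  fix \<tau> \<sigma>
  assume "term_equivalence TYPE(nat) irl_arity irl isr_arity isr \<tau> \<sigma>"
  \<comment> \<open>Both classes equal their axiomatized forms over \<open>nat\<close> and over
    \<open>'a\<close> alike, so the transfer lemma applies.\<close>
  then show "term_equivalence TYPE('a) irl_arity irl isr_arity isr \<tau> \<sigma>"
    using term_equivalence_transfer[OF is_qf_irl_axioms is_qf_isr_axioms]
    by (simp add: irl_iff_models[abs_def] isr_iff_models[abs_def])
qed

end
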